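(* Let $N\ge 2$ and $k\ge 0$ be integers. Let $v:\mathbb R^N\to\mathbb R^N$ be of class $C^k(\mathbb R^N)\cap C^1(\mathbb R^N)$ and let $p:\mathbb R^N\to\mathbb R$ be of class $C^1(\mathbb R^N)$. Let $\Phi[v]:\mathbb R^N\to\mathbb R^N$ be a continuous function of the form $$\Phi[v](x)=\Phi_k\bigl(x,v(x),Dv(x),\dots,D^kv(x)\bigr),\qquad x\in\mathbb R^N,$$ for some function $\Phi_k:\mathbb R^M\to\mathbb R^N$, with $M=M(N,k)$ the appropriate dimension. Assume that: (i) $(v,p)$ solves the forced steady Euler equations on $\mathbb R^N$: $$(v\cdot\nabla)v=-\nabla p+\Phi[v],\qquad \operatorname{div} v=0;$$ (ii) either $\Phi[v](x)\cdot v(x)\ge 0$ for all $x\in\mathbb R^N$, or $\Phi[v](x)\cdot v(x)\le 0$ for all $x\in\mathbb R^N$; (iii) for $x\in\mathbb R^N$, $\Phi[v](x)\cdot v(x)=0$ if and only if $v(x)=0$; (iv) there exists $q\in\left(\frac{3N}{N-1},\infty\right)$ such that $|v|^2+|p|\in L^{q/2}(\mathbb R^N)$. Then $v=0$ on $\mathbb R^N$.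
   Context: $D^jv$ denotes the collection of all partial derivatives of order $j$ of the components of $v$; $(v\cdot\nabla)v$ is the vector field with components $\sum_{j=1}^N v_j\partial_j v_i$, $i=1,\dots,N$. *)

theory Defs
  imports "HOL-Analysis.Analysis"
begin

definition partial_deriv :: "'n \<Rightarrow> (real ^ 'n \<Rightarrow> real) \<Rightarrow> real ^ 'n \<Rightarrow> real" where
  "partial_deriv i f x = deriv (\<lambda>t. f (x + t *\<^sub>R axis i 1)) 0"

definition has_partial_derivs :: "(real ^ 'n \<Rightarrow> real) \<Rightarrow> bool" where
  "has_partial_derivs f \<longleftrightarrow>
     (\<forall>i x. (\<lambda>t. f (x + t *\<^sub>R axis i 1)) field_differentiable at 0)"

fun iter_partial :: "'n list \<Rightarrow> (real ^ 'n \<Rightarrow> real) \<Rightarrow> real ^ 'n \<Rightarrow> real" where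
  "iter_partial [] f = f"
| "iter_partial (i # is) f = partial_deriv i (iter_partial is f)"

definition Ck :: "nat \<Rightarrow> (real ^ 'n::finite \<Rightarrow> real) \<Rightarrow> bool" where
  "Ck k f \<longleftrightarrow>
     (\<forall>is. length is < k \<longrightarrow> has_partial_derivs (iter_partial is f)) \<and>
     (\<forall>is. length is \<le> k \<longrightarrow> continuous_on UNIV (iter_partial is f))"

definition Ck_vec :: "nat \<Rightarrow> (real ^ 'n::finite \<Rightarrow> real ^ 'n) \<Rightarrow> bool" where
  "Ck_vec k v \<longleftrightarrow> (\<forall>i. Ck k (\<lambda>x. v x $ i))"

text \<open>
  The tuple \<open>(v(x), Dv(x), \<dots>, D\<^sup>k v(x))\<close>. Its entries are indexed by pairs of a list of
  differentiation directions, of length at most \<open>k\<close>, and a component of \<open>v\<close>. This index set is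
  finite; outside of it the tuple is \<open>undefined\<close>, so that a function of \<open>jet k v x\<close> sees no
  derivative of order above \<open>k\<close>. Mixed derivatives occur once for each order of differentiation.
\<close>

definition jet :: "nat \<Rightarrow> (real ^ 'n \<Rightarrow> real ^ 'n) \<Rightarrow> real ^ 'n \<Rightarrow> 'n list \<times> 'n \<Rightarrow> real" where
  "jet k v x =
     restrict (\<lambda>(is, i). iter_partial is (\<lambda>y. v y $ i) x) ({is. length is \<le> k} \<times> UNIV)"

definition grad :: "(real ^ 'n \<Rightarrow> real) \<Rightarrow> real ^ 'n \<Rightarrow> real ^ 'n" where
  "grad p x = (\<chi> i. partial_deriv i p x)"

definition divergence :: "(real ^ 'n::finite \<Rightarrow> real ^ 'n) \<Rightarrow> real ^ 'n \<Rightarrow> real" where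
  "divergence v x = (\<Sum>i\<in>UNIV. partial_deriv i (\<lambda>y. v y $ i) x)"

definition advection :: "(real ^ 'n::finite \<Rightarrow> real ^ 'n) \<Rightarrow> real ^ 'n \<Rightarrow> real ^ 'n" where
  "advection v x = (\<chi> i. \<Sum>j\<in>UNIV. v x $ j * partial_deriv j (\<lambda>y. v y $ i) x)"

definition in_Lp :: "real \<Rightarrow> (real ^ 'n::finite \<Rightarrow> real) \<Rightarrow> bool" where
  "in_Lp r f \<longleftrightarrow>
     f \<in> borel_measurable lebesgue \<and> integrable lebesgue (\<lambda>x. \<bar>f x\<bar> powr r)"

end

(* Let B = |v|^2/2 + p. Taking the inner product of the Euler equations with v gives
   v \<bullet> grad B = \<Phi> \<bullet> v, and as v is divergence free, div (F(B) v) = F'(B) (\<Phi> \<bullet> v) for every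
   C^1 function F. For F(b) = b |b|^a with a = (q - 3)/2 > 0 the field F(B) v is dominated by
   (|v|^2 + |p|)^(q/2), hence integrable, while its divergence (1 + a) |B|^a (\<Phi> \<bullet> v) has a
   constant sign. Testing with a cutoff at scale R shows that this divergence has integral 0, so
   it vanishes identically. Where v \<noteq> 0 this forces B = 0 in a neighbourhood, whence
   \<Phi> \<bullet> v = v \<bullet> grad B = 0, which contradicts (iii). *)
theory Submission
  imports Defs
begin

section \<open>Derivatives of compactly supported functions integrate to zero\<close>

text \<open>By translation invariance every difference quotient along \<open>u\<close> has integral
  0. The mean value theorem bounds the quotients by a constant on a fixed ball, outside which they
  vanish, so dominated convergence carries the value 0 over to their limit \<open>D\<close>.\<close>

lemma integral_directional_derivative_eq_0:
  fixes f D :: "'a::euclidean_space \<Rightarrow> real" and u :: 'a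
  assumes contf: "continuous_on UNIV f" and contD: "continuous_on UNIV D"
    and der: "\<And>x. ((\<lambda>t. f (x + t *\<^sub>R u)) has_real_derivative D x) (at 0)"
    and supp: "\<And>x. norm x > R \<Longrightarrow> f x = 0"
  shows "integrable lborel D" "integral\<^sup>L lborel D = 0"
proof -
  define Q where "Q = (\<lambda>n x. (f (x + (1 / real (Suc n)) *\<^sub>R u) - f x) * real (Suc n))"
  \<comment> \<open>With step length at most 1, the quotients vanish outside radius
    \<open>R + norm u\<close>. The mean value points lie up to \<open>norm u\<close> further out,
    hence the factor 2.\<close>
  obtain M where M: "\<And>x. x \<in> cball 0 (R + 2 * norm u) \<Longrightarrow> norm (D x) \<le> M"
    using compact_imp_bounded[OF compact_continuous_image[OF continuous_on_subset[OF contD subset_UNIV] compact_cball]]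
    unfolding bounded_iff by (metis image_eqI)
  \<comment> \<open>The hypothesis gives derivatives at parameter 0 for every base point; shifting
    the base point gives them along the whole line, as the mean value theorem requires.\<close>
  have der': "((\<lambda>t. f (x + t *\<^sub>R u)) has_real_derivative D (x + s *\<^sub>R u)) (at s)" for x s
  proof -
    have "((\<lambda>t. f ((x + s *\<^sub>R u) + t *\<^sub>R u)) has_real_derivative D (x + s *\<^sub>R u)) (at 0)"
      by (rule der)
    moreover have "(x + s *\<^sub>R u) + t *\<^sub>R u = x + (t + s) *\<^sub>R u" for t
      by (simp add: algebra_simps)
    ultimately have "((\<lambda>t. f (x + (t + s) *\<^sub>R u)) has_real_derivative D (x + s *\<^sub>R u)) (at 0)"
      by simp
    then show ?thesis
      using DERIV_shift[of "\<lambda>t. f (x + t *\<^sub>R u)" "D (x + s *\<^sub>R u)" 0 s] by simp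
  qed
  have intf: "integrable lborel f"
  proof -
    have "integrable lborel (\<lambda>x. indicator (cball 0 R) x *\<^sub>R f x)"
      by (rule borel_integrable_compact) (auto intro: continuous_on_subset[OF contf])
    moreover have "(\<lambda>x. indicator (cball 0 R) x *\<^sub>R f x) = f"
      using supp by (auto simp: fun_eq_iff indicator_def)
    ultimately show ?thesis by simp
  qed
  have shift: "integrable lborel (\<lambda>x. f (x + c))" "(\<integral>x. f (x + c) \<partial>lborel) = integral\<^sup>L lborel f" for c
  proof -
    have [measurable]: "f \<in> borel_measurable borel"
      using contf by (rule borel_measurable_continuous_onI)
    have "integrable (distr lborel borel ((+) c)) f" "integral\<^sup>L (distr lborel borel ((+) c)) f = integral\<^sup>L lborel f"
      using intf by (simp_all add: lborel_distr_plus)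
    then show "integrable lborel (\<lambda>x. f (x + c))" "(\<integral>x. f (x + c) \<partial>lborel) = integral\<^sup>L lborel f"
      by (simp_all add: integrable_distr_eq integral_distr add.commute)
  qed
  have IQ: "integral\<^sup>L lborel (Q n) = 0" for n
    using shift intf unfolding Q_def by simp
  have lim: "(\<lambda>n. Q n x) \<longlonglongrightarrow> D x" for x
  proof -
    have "((\<lambda>h. (f (x + h *\<^sub>R u) - f x) / h) \<longlongrightarrow> D x) (at 0)"
      using der[of x] by (simp add: DERIV_def)
    moreover have "filterlim (\<lambda>n. 1 / real (Suc n)) (at 0) sequentially"
      using LIMSEQ_Suc[OF lim_1_over_n[where 'a=real]] by (simp add: filterlim_at)
    ultimately have "(\<lambda>n. (f (x + (1 / real (Suc n)) *\<^sub>R u) - f x) / (1 / real (Suc n))) \<longlonglongrightarrow> D x"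
      by (rule filterlim_compose)
    then show ?thesis by (simp add: Q_def)
  qed
  have bound: "norm (Q n x) \<le> indicator (cball 0 (R + norm u)) x * M" for n x
  proof -
    define t where "t = 1 / real (Suc n)"
    have t: "0 < t" "t \<le> 1" by (simp_all add: t_def)
    have tu: "norm (s *\<^sub>R u) \<le> norm u" if "0 \<le> s" "s \<le> t" for s
      using that t by (simp add: mult_left_le_one_le)
    show ?thesis
    proof (cases "x \<in> cball 0 (R + norm u)")
      case True
      obtain z where z: "0 < z" "z < t"
        and eq: "f (x + t *\<^sub>R u) - f (x + 0 *\<^sub>R u) = (t - 0) * D (x + z *\<^sub>R u)"
        using MVT2[OF t(1), of "\<lambda>t. f (x + t *\<^sub>R u)" "\<lambda>s. D (x + s *\<^sub>R u)"] der' by blast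
      have "Q n x = D (x + z *\<^sub>R u)"
        using eq t by (simp add: Q_def t_def field_simps)
      moreover have "norm (x + z *\<^sub>R u) \<le> R + 2 * norm u"
        using norm_triangle_ineq[of x "z *\<^sub>R u"] tu[of z] z True by auto
      ultimately show ?thesis
        using M True by simp
    next
      case False
      then have x: "norm x > R + norm u" by simp
      then have "norm (x + t *\<^sub>R u) > R"
        using norm_diff_ineq[of x "t *\<^sub>R u"] tu[of t] t by linarith
      moreover have "norm x > R" using x norm_ge_zero[of u] by linarith
      ultimately have "Q n x = 0"
        using supp by (simp add: Q_def t_def)
      then show ?thesis using False by simp
    qed
  qed
  have meas: "Q n \<in> borel_measurable lborel" "D \<in> borel_measurable lborel" for n
    unfolding Q_def measurable_lborel2
    by (intro borel_measurable_continuous_onI continuous_intros continuous_on_compose2[OF contf] contD; simp)+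
  have w: "integrable lborel (\<lambda>x. indicator (cball 0 (R + norm u)) x * M)"
    using borel_integrable_compact[of "cball 0 (R + norm u)" "\<lambda>_. M"]
    by (simp del: integrable_mult_left_iff)
  note dc = meas(2) meas(1) w AE_I2[OF lim] AE_I2[OF bound]
  show "integrable lborel D"
    by (rule integrable_dominated_convergence[OF dc])
  have "(\<lambda>n. integral\<^sup>L lborel (Q n)) \<longlonglongrightarrow> integral\<^sup>L lborel D"
    by (rule integral_dominated_convergence[OF dc])
  then show "integral\<^sup>L lborel D = 0"
    by (simp add: IQ LIMSEQ_const_iff)
qed

section \<open>An explicit cutoff function and its bounds\<close>

text \<open>Squaring removes the corner of the positive part: at 0 the difference quotient is at
  most \<open>\<bar>h\<bar>\<close> in absolute value. This is what makes \<open>cutoff\<close>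
  continuously differentiable.\<close>

lemma DERIV_max_0_square: "((\<lambda>z::real. (max 0 z)\<^sup>2) has_real_derivative 2 * max 0 z) (at z)"
proof -
  consider "z > 0" | "z < 0" | "z = 0" by linarith
  then show ?thesis
  proof cases
    case 1
    have "((\<lambda>z::real. z\<^sup>2) has_real_derivative 2 * z) (at z)"
      by (auto intro!: derivative_eq_intros)
    then show ?thesis using 1
      by (rule_tac has_field_derivative_transform_within_open[where S="{0<..}" and f="\<lambda>z. z\<^sup>2"]) auto
  next
    case 2
    then show ?thesis
      by (rule_tac has_field_derivative_transform_within_open[where S="{..<0}" and f="\<lambda>z. 0"]) auto
  next
    case 3
    have "((\<lambda>h::real. (max 0 h)\<^sup>2 / h) \<longlongrightarrow> 0) (at 0)"
      by (rule Lim_null_comparison[where g=abs])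
        (auto simp: eventually_at power2_eq_square max_def intro!: exI[of _ 1] tendsto_eq_intros)
    then show ?thesis using 3 by (simp add: DERIV_def)
  qed
qed

text \<open>For \<open>R > 0\<close> this is a C^1 bump supported in the closed ball of radius
  \<open>R\<close>. It is a polynomial inside the ball, so its derivative is explicit and no
  mollifier enters.\<close>

definition cutoff :: "real \<Rightarrow> 'a::real_inner \<Rightarrow> real" where
  "cutoff R x = (max 0 (1 - (x \<bullet> x) / R\<^sup>2))\<^sup>2"

definition cutoff_deriv :: "real \<Rightarrow> 'a::real_inner \<Rightarrow> 'a \<Rightarrow> real" where
  "cutoff_deriv R u x = - 4 * max 0 (1 - (x \<bullet> x) / R\<^sup>2) * (x \<bullet> u) / R\<^sup>2"

lemma DERIV_cutoff:
  "((\<lambda>t. cutoff R (x + t *\<^sub>R u)) has_real_derivative cutoff_deriv R u x) (at 0)"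
proof -
  \<comment> \<open>For \<open>R = 0\<close> division by zero yields 0: the inner function is
    constant and the stated derivative is 0.\<close>
  have "((\<lambda>t. 1 - ((x + t *\<^sub>R u) \<bullet> (x + t *\<^sub>R u)) / R\<^sup>2) has_real_derivative - (2 * (x \<bullet> u)) / R\<^sup>2) (at 0)"
    by (cases "R = 0")
      (auto intro!: derivative_eq_intros simp: inner_add_left inner_add_right inner_commute field_simps)
  from DERIV_chain2[OF DERIV_max_0_square this]
  show ?thesis by (simp add: cutoff_def cutoff_deriv_def algebra_simps)
qed

lemma continuous_cutoff: "continuous_on UNIV (cutoff R)" "continuous_on UNIV (cutoff_deriv R u)"
  unfolding cutoff_def[abs_def] cutoff_deriv_def[abs_def]
  by (cases "R = 0"; auto intro!: continuous_intros)+

lemma cutoff_eq_0: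
  fixes x :: "'a::real_inner"
  assumes "norm x > R" "R > 0"
  shows "cutoff R x = 0" "cutoff_deriv R u x = 0"
proof -
  have "R\<^sup>2 \<le> x \<bullet> x"
    using assms by (simp add: dot_square_norm power_mono)
  then have "max 0 (1 - (x \<bullet> x) / R\<^sup>2) = 0" using assms by (simp add: max_def field_simps)
  then show "cutoff R x = 0" "cutoff_deriv R u x = 0"
    by (simp_all add: cutoff_def cutoff_deriv_def)
qed

text \<open>On the ball, Cauchy-Schwarz bounds \<open>x \<bullet> u\<close> by
  \<open>R * norm u\<close>, which cancels one factor of \<open>R\<^sup>2\<close>. The remaining
  decay 1/R makes the boundary error vanish for an integrable field.\<close>

lemma cutoff_deriv_bound:
  fixes x :: "'a::real_inner"
  assumes "R > 0"
  shows "\<bar>cutoff_deriv R u x\<bar> \<le> 4 * norm u / R"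
proof (cases "norm x > R")
  case True
  then show ?thesis using assms by (simp add: cutoff_eq_0)
next
  case False
  define m where "m = max 0 (1 - (x \<bullet> x) / R\<^sup>2)"
  have m: "0 \<le> m" "m \<le> 1" by (auto simp: m_def)
  have "\<bar>x \<bullet> u\<bar> \<le> R * norm u"
    using Cauchy_Schwarz_ineq2[of x u] False mult_right_mono[of "norm x" R "norm u"] by simp
  then have "m * \<bar>x \<bullet> u\<bar> \<le> 1 * (R * norm u)"
    using m by (intro mult_mono) auto
  then have "4 * (m * \<bar>x \<bullet> u\<bar>) / R\<^sup>2 \<le> 4 * (R * norm u) / R\<^sup>2"
    by (intro divide_right_mono) auto
  then show ?thesis
    using assms m unfolding cutoff_deriv_def m_def[symmetric]
    by (simp add: abs_mult power2_eq_square)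
qed

text \<open>Lets an integral at a fixed radius be compared with those at arbitrarily large radii
  when the integrand is nonnegative.\<close>

lemma cutoff_mono:
  fixes x :: "'a::real_inner"
  assumes "0 < r" "r \<le> R"
  shows "cutoff r x \<le> cutoff R x"
proof -
  have "(x \<bullet> x) / R\<^sup>2 \<le> (x \<bullet> x) / r\<^sup>2"
    using assms by (intro divide_left_mono power_mono mult_pos_pos) auto
  then show ?thesis
    unfolding cutoff_def by (intro power_mono) auto
qed

lemma cutoff_pos:
  fixes x :: "'a::real_inner"
  assumes "norm x < R"
  shows "cutoff R x > 0"
proof -
  have "R > 0" using assms norm_ge_zero[of x] by linarith
  moreover have "x \<bullet> x < R\<^sup>2"
    using assms by (simp add: dot_square_norm power_strict_mono)
  ultimately show ?thesis by (simp add: cutoff_def)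
qed

lemma cutoff_nonneg: "cutoff R x \<ge> 0"
  by (simp add: cutoff_def)

section \<open>Integrable fields with divergence of constant sign\<close>

text \<open>The set where \<open>f\<close> is nonzero is open by continuity and null by the zero
  integral, hence empty.\<close>

lemma continuous_nonneg_integral_0:
  fixes f :: "'a::euclidean_space \<Rightarrow> real"
  assumes cont: "continuous_on UNIV f" and nonneg: "\<And>x. f x \<ge> 0"
    and int: "integrable lborel f" and zero: "integral\<^sup>L lborel f = 0"
  shows "f x = 0"
proof (rule ccontr)
  assume "f x \<noteq> 0"
  have "AE y in lborel. f y = 0"
    using integral_nonneg_eq_0_iff_AE[OF int] nonneg zero by simp
  moreover have "open {y. f y \<noteq> 0}"
    using cont by (intro open_Collect_neq continuous_intros)
  ultimately have "{y. f y \<noteq> 0} \<in> null_sets lborel"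
    using AE_iff_null_sets[of "{y. f y \<noteq> 0}" lborel] by simp
  then have "negligible {y. f y \<noteq> 0}"
    by (simp add: negligible_iff_null_sets null_sets_completionI)
  then show False
    using open_not_negligible \<open>open {y. f y \<noteq> 0}\<close> \<open>f x \<noteq> 0\<close> by blast
qed

text \<open>The sum of the \<open>D i\<close> is the divergence of the field with parts
  \<open>H i\<close> along \<open>u i\<close>. Tested against \<open>cutoff R\<close> it has
  integral at most C/R, and its sign then forces it to vanish. Integrability is assumed of the
  field, not of its divergence.\<close>

lemma integrable_field_divergence_nonneg_eq_0:
  fixes u :: "'i \<Rightarrow> 'a::euclidean_space" and H D :: "'i \<Rightarrow> 'a \<Rightarrow> real"
  assumes contH: "\<And>i. i \<in> I \<Longrightarrow> continuous_on UNIV (H i)"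
    and contD: "\<And>i. i \<in> I \<Longrightarrow> continuous_on UNIV (D i)"
    and der: "\<And>i x. i \<in> I \<Longrightarrow> ((\<lambda>t. H i (x + t *\<^sub>R u i)) has_real_derivative D i x) (at 0)"
    and int: "\<And>i. i \<in> I \<Longrightarrow> integrable lborel (H i)"
    and nonneg: "\<And>x. (\<Sum>i\<in>I. D i x) \<ge> 0"
  shows "(\<Sum>i\<in>I. D i x) = 0"
proof -
  define G where "G x = (\<Sum>i\<in>I. D i x)" for x
  \<comment> \<open>Each summand is the bound on the derivative of the cutoff, without its factor
    1/R, times the L^1 norm of \<open>H i\<close>.\<close>
  define C where "C = (\<Sum>i\<in>I. 4 * norm (u i) * (\<integral>x. \<bar>H i x\<bar> \<partial>lborel))"
  have contG: "continuous_on UNIV G"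
    unfolding G_def using contD by (intro continuous_intros)
  have main: "integrable lborel (\<lambda>x. cutoff R x * G x) \<and> (\<integral>x. cutoff R x * G x \<partial>lborel) \<le> C / R"
    if R: "R > 0" for R
  proof -
    \<comment> \<open>\<open>E i\<close> is the full derivative of the compactly supported product
      of \<open>cutoff R\<close> and \<open>H i\<close>, so it integrates to 0; \<open>K i\<close>
      is the part in which the cutoff is differentiated.\<close>
    define E where "E i x = cutoff_deriv R (u i) x * H i x + D i x * cutoff R x" for i x
    define K where "K i x = cutoff_deriv R (u i) x * H i x" for i x
    have E: "integrable lborel (E i)" "integral\<^sup>L lborel (E i) = 0" if i: "i \<in> I" for i
    proof -
      have 1: "continuous_on UNIV (\<lambda>x. cutoff R x * H i x)" "continuous_on UNIV (E i)"
        unfolding E_def using contH[OF i] contD[OF i] continuous_cutoff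
        by (auto intro!: continuous_intros)
      have 2: "((\<lambda>t. cutoff R (x + t *\<^sub>R u i) * H i (x + t *\<^sub>R u i)) has_real_derivative E i x) (at 0)" for x
        using DERIV_mult[OF DERIV_cutoff[of R x "u i"] der[OF i, of x]]
        by (simp add: E_def mult.commute)
      have 3: "cutoff R x * H i x = 0" if "norm x > R" for x
        using cutoff_eq_0[OF that R] by simp
      show "integrable lborel (E i)" "integral\<^sup>L lborel (E i) = 0"
        using integral_directional_derivative_eq_0[OF 1 2 3] by auto
    qed
    have le: "\<bar>K i x\<bar> \<le> 4 * norm (u i) / R * \<bar>H i x\<bar>" for i x
      unfolding K_def abs_mult using cutoff_deriv_bound[OF R] by (intro mult_right_mono) auto
    have K: "integrable lborel (K i)" if i: "i \<in> I" for i
    proof (rule Bochner_Integration.integrable_bound)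
      show "integrable lborel (\<lambda>x. 4 * norm (u i) / R * \<bar>H i x\<bar>)"
        using int[OF i] by (intro integrable_mult_right integrable_abs)
      show "K i \<in> borel_measurable lborel"
        unfolding K_def[abs_def] measurable_lborel2
        by (intro borel_measurable_continuous_onI continuous_intros continuous_cutoff contH i)
      show "AE x in lborel. norm (K i x) \<le> norm (4 * norm (u i) / R * \<bar>H i x\<bar>)"
        using le R by (auto simp: abs_mult)
    qed
    have eq: "cutoff R x * G x = (\<Sum>i\<in>I. E i x - K i x)" for x
      by (simp add: G_def E_def K_def sum_distrib_left mult.commute)
    have "integrable lborel (\<lambda>x. cutoff R x * G x)"
      unfolding eq using E K by (intro Bochner_Integration.integrable_sum Bochner_Integration.integrable_diff)
    moreover have "(\<integral>x. cutoff R x * G x \<partial>lborel) = (\<Sum>i\<in>I. - integral\<^sup>L lborel (K i))"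
      unfolding eq using E K by (simp add: Bochner_Integration.integral_sum)
    moreover have "- integral\<^sup>L lborel (K i) \<le> 4 * norm (u i) * (\<integral>x. \<bar>H i x\<bar> \<partial>lborel) / R" if i: "i \<in> I" for i
    proof -
      have "- integral\<^sup>L lborel (K i) = (\<integral>x. - K i x \<partial>lborel)"
        by simp
      also have "\<dots> \<le> (\<integral>x. 4 * norm (u i) / R * \<bar>H i x\<bar> \<partial>lborel)"
        using K[OF i] int[OF i] le[of i]
        by (intro integral_mono integrable_mult_right integrable_abs) (auto simp: abs_le_iff)
      finally show ?thesis by simp
    qed
    ultimately show ?thesis
      by (auto simp: C_def sum_divide_distrib intro: sum_mono)
  qed
  \<comment> \<open>A radius beyond \<open>norm x\<close> keeps the cutoff positive at
    \<open>x\<close>, so that it can be cancelled at the end.\<close>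
  define r where "r = norm x + 1"
  have r: "r > 0" "norm x < r" by (auto simp: r_def add_nonneg_pos)
  have nn: "cutoff r y * G y \<ge> 0" for y
    unfolding G_def by (rule mult_nonneg_nonneg[OF cutoff_nonneg nonneg])
  \<comment> \<open>The radius \<open>r\<close> stays fixed while \<open>R\<close> tends to
    infinity.\<close>
  have "(\<integral>x. cutoff r x * G x \<partial>lborel) \<le> C / R" if "R \<ge> r" for R
  proof -
    have "(\<integral>x. cutoff r x * G x \<partial>lborel) \<le> (\<integral>x. cutoff R x * G x \<partial>lborel)"
      using main[of r] main[of R] r that nonneg
      by (intro integral_mono) (auto simp: G_def intro!: mult_right_mono cutoff_mono)
    then show ?thesis using main[of R] r that by linarith
  qed
  moreover have "((\<lambda>R. C / R) \<longlongrightarrow> 0) at_top"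
    by (intro tendsto_divide_0[OF tendsto_const] filterlim_at_top_imp_at_infinity filterlim_ident)
  ultimately have "(\<integral>x. cutoff r x * G x \<partial>lborel) \<le> 0"
    by (intro tendsto_lowerbound[where F=at_top and f="\<lambda>R. C / R"])
      (auto simp: eventually_at_top_linorder)
  moreover have "(\<integral>x. cutoff r x * G x \<partial>lborel) \<ge> 0"
    using nn by (intro integral_nonneg_AE) auto
  ultimately have "(\<integral>x. cutoff r x * G x \<partial>lborel) = 0"
    by (rule antisym)
  moreover have "continuous_on UNIV (\<lambda>x. cutoff r x * G x)"
    by (intro continuous_intros continuous_cutoff contG)
  ultimately have "cutoff r x * G x = 0"
    using continuous_nonneg_integral_0[of "\<lambda>x. cutoff r x * G x"] main[OF r(1)] nn by blast
  then show ?thesis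
    using cutoff_pos[OF r(2)] by (simp add: G_def)
qed

section \<open>Signed powers and C^1 functions\<close>

text \<open>Away from 0 this is a signed power with exponent \<open>1 + a\<close>; at 0 the quotient
  \<open>\<bar>h\<bar> powr a\<close> tends to 0 because \<open>a > 0\<close>. Keeping the sign of
  \<open>b\<close> makes the derivative nonnegative everywhere.\<close>

lemma DERIV_times_abs_powr:
  fixes a b :: real
  assumes "a > 0"
  shows "((\<lambda>b. b * \<bar>b\<bar> powr a) has_real_derivative (1 + a) * \<bar>b\<bar> powr a) (at b)"
proof -
  consider "b > 0" | "b < 0" | "b = 0" by linarith
  then show ?thesis
  proof cases
    case 1
    have "((\<lambda>b. b powr (1 + a)) has_real_derivative (1 + a) * b powr a) (at b)"
      using 1 by (auto intro!: derivative_eq_intros)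
    then show ?thesis using 1
      by (rule_tac has_field_derivative_transform_within_open[where S="{0<..}" and f="\<lambda>b. b powr (1 + a)"])
        (auto simp: powr_add)
  next
    case 2
    have "((\<lambda>b. - ((- b) powr (1 + a))) has_real_derivative (1 + a) * (- b) powr a) (at b)"
      using 2 by (auto intro!: derivative_eq_intros)
    then show ?thesis using 2
      by (rule_tac has_field_derivative_transform_within_open[where S="{..<0}" and f="\<lambda>b. - ((- b) powr (1 + a))"])
        (auto simp: powr_add)
  next
    case 3
    have "((\<lambda>h. \<bar>h\<bar> powr a) \<longlongrightarrow> \<bar>0\<bar> powr a) (at (0::real))"
      using assms by (intro tendsto_intros) auto
    then have "((\<lambda>h. (h * \<bar>h\<bar> powr a) / h) \<longlongrightarrow> 0) (at (0::real))"
      using assms by (auto elim!: Lim_transform_eventually simp: eventually_at intro!: exI[of _ 1])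
    then show ?thesis using 3 by (simp add: DERIV_def)
  qed
qed

lemma Ck_1D:
  assumes "Ck 1 f"
  shows "continuous_on UNIV f" "continuous_on UNIV (partial_deriv i f)"
    and "((\<lambda>t. f (x + t *\<^sub>R axis i 1)) has_real_derivative partial_deriv i f x) (at 0)"
proof -
  have "continuous_on UNIV (iter_partial [] f)" "continuous_on UNIV (iter_partial [i] f)"
    using assms unfolding Ck_def by (metis le_numeral_extra(4) list.size(3) zero_le_one, metis length_Cons list.size(3) One_nat_def order_refl)
  then show "continuous_on UNIV f" "continuous_on UNIV (partial_deriv i f)"
    by simp_all
  have "has_partial_derivs (iter_partial [] f)"
    using assms unfolding Ck_def by (metis list.size(3) zero_less_one)
  then show "((\<lambda>t. f (x + t *\<^sub>R axis i 1)) has_real_derivative partial_deriv i f x) (at 0)"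
    by (simp add: has_partial_derivs_def partial_deriv_def field_differentiable_derivI)
qed

section \<open>The Bernoulli function of an Euler flow\<close>

theorem theorem1p1:
  fixes v :: "real ^ 'n::finite \<Rightarrow> real ^ 'n"
    and p :: "real ^ 'n \<Rightarrow> real"
    and \<Phi> :: "real ^ 'n \<Rightarrow> real ^ 'n"
    and \<Phi>\<^sub>k :: "real ^ 'n \<Rightarrow> ('n list \<times> 'n \<Rightarrow> real) \<Rightarrow> real ^ 'n"
    and k :: nat
  assumes "CARD('n) \<ge> 2"
    and "Ck_vec k v" and "Ck_vec 1 v" and "Ck 1 p"
    and "continuous_on UNIV \<Phi>"
    and "\<And>x. \<Phi> x = \<Phi>\<^sub>k x (jet k v x)"
    and "\<And>x. advection v x = - grad p x + \<Phi> x"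
    and "\<And>x. divergence v x = 0"
    and "(\<forall>x. \<Phi> x \<bullet> v x \<ge> 0) \<or> (\<forall>x. \<Phi> x \<bullet> v x \<le> 0)"
    and "\<And>x. \<Phi> x \<bullet> v x = 0 \<longleftrightarrow> v x = 0"
    and "\<exists>q::real. q > 3 * real CARD('n) / (real CARD('n) - 1) \<and>
           in_Lp (q / 2) (\<lambda>x. (norm (v x))\<^sup>2 + \<bar>p x\<bar>)"
  shows "\<forall>x. v x = 0"
proof -
  obtain q where q: "q > 3 * real CARD('n) / (real CARD('n) - 1)"
    and Lq: "in_Lp (q / 2) (\<lambda>x. (norm (v x))\<^sup>2 + \<bar>p x\<bar>)"
    using assms(11) by blast
  \<comment> \<open>As N is at least 2, the lower bound on \<open>q\<close> exceeds 3, which makes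
    the exponent \<open>a\<close> positive.\<close>
  have "3 < 3 * real CARD('n) / (real CARD('n) - 1)"
    using assms(1) by (simp add: field_simps)
  then have q3: "q > 3" using q by linarith
  \<comment> \<open>Chosen so that 1/2 + (1 + a) = q/2: the factor \<open>v\<close> costs exponent
    1/2 and the signed power of \<open>B\<close> costs 1 + a.\<close>
  define a where "a = (q - 3) / 2"
  have a: "a > 0" using q3 by (simp add: a_def)
  \<comment> \<open>The Bernoulli function; the coordinate sum lets the partial derivatives be
    computed termwise.\<close>
  define B where "B x = (\<Sum>i\<in>UNIV. (v x $ i)\<^sup>2) / 2 + p x" for x
  define dB where "dB j x = (\<Sum>i\<in>UNIV. v x $ i * partial_deriv j (\<lambda>y. v y $ i) x) + partial_deriv j p x" for j x
  define w where "w x = (norm (v x))\<^sup>2 + \<bar>p x\<bar>" for x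
  define F where "F x = B x * \<bar>B x\<bar> powr a" for x
  define dF where "dF x = (1 + a) * \<bar>B x\<bar> powr a" for x
  define H where "H j x = v x $ j * F x" for j x
  define D where "D j x = partial_deriv j (\<lambda>y. v y $ j) x * F x + dF x * dB j x * v x $ j" for j x
  have Cv: "Ck 1 (\<lambda>y. v y $ i)" for i
    using assms(3) by (simp add: Ck_vec_def)
  note v1 = Ck_1D[OF Cv] and p1 = Ck_1D[OF assms(4)]
  have contB: "continuous_on UNIV B" and contdB: "continuous_on UNIV (dB j)" for j
    unfolding B_def dB_def by (intro continuous_intros v1 p1; simp)+
  have contF: "continuous_on UNIV F" and contdF: "continuous_on UNIV dF"
    unfolding F_def dF_def using a by (auto intro!: continuous_intros contB continuous_on_powr')
  have derB: "((\<lambda>t. B (x + t *\<^sub>R axis j 1)) has_real_derivative dB j x) (at 0)" for j x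
    unfolding B_def dB_def
    by (rule derivative_eq_intros v1(3) p1(3) refl | simp)+
      (simp add: sum_divide_distrib sum_distrib_left mult.commute)
  have derF: "((\<lambda>t. F (x + t *\<^sub>R axis j 1)) has_real_derivative dF x * dB j x) (at 0)" for j x
    using DERIV_chain2[OF DERIV_times_abs_powr[OF a] derB[of x j]] by (simp add: F_def dF_def)
  have derH: "((\<lambda>t. H j (x + t *\<^sub>R axis j 1)) has_real_derivative D j x) (at 0)" for j x
    using DERIV_mult[OF v1(3)[where i=j and x=x] derF[of x j]] by (simp add: H_def D_def)
  have contH: "continuous_on UNIV (H j)" and contD: "continuous_on UNIV (D j)" for j
    unfolding H_def D_def by (intro continuous_intros v1 contF contdF contdB)+
  \<comment> \<open>Exchanging the sums turns the quadratic part into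
    \<open>advection v x \<bullet> v x\<close>; the pressure gradient then cancels against the one
    in the Euler equations.\<close>
  have energy: "(\<Sum>j\<in>UNIV. v x $ j * dB j x) = \<Phi> x \<bullet> v x" for x
  proof -
    have "(\<Sum>j\<in>UNIV. v x $ j * dB j x)
      = (\<Sum>j\<in>UNIV. \<Sum>i\<in>UNIV. v x $ j * (v x $ i * partial_deriv j (\<lambda>y. v y $ i) x)) + grad p x \<bullet> v x"
      by (simp add: dB_def grad_def inner_vec_def distrib_left sum.distrib sum_distrib_left mult.commute)
    also have "(\<Sum>j\<in>UNIV. \<Sum>i\<in>UNIV. v x $ j * (v x $ i * partial_deriv j (\<lambda>y. v y $ i) x))
      = advection v x \<bullet> v x"
      by (subst sum.swap) (simp add: advection_def inner_vec_def sum_distrib_left sum_distrib_right mult_ac)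
    finally show ?thesis using assms(7)[of x] by (simp add: inner_diff_left)
  qed
  have div: "(\<Sum>j\<in>UNIV. D j x) = dF x * (\<Phi> x \<bullet> v x)" for x
  proof -
    have "(\<Sum>j\<in>UNIV. D j x) = divergence v x * F x + dF x * (\<Sum>j\<in>UNIV. v x $ j * dB j x)"
      by (simp add: D_def divergence_def sum.distrib sum_distrib_left sum_distrib_right mult_ac)
    then show ?thesis using assms(8) energy by simp
  qed
  have intH: "integrable lborel (H j)" for j
  proof -
    \<comment> \<open>Both \<open>\<bar>B x\<bar> \<le> w x\<close> and
      \<open>\<bar>v x $ j\<bar> \<le> sqrt (w x)\<close> hold, so the exponents add up to
      q/2.\<close>
    have le: "\<bar>H j x\<bar> \<le> \<bar>w x\<bar> powr (q / 2)" for x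
    proof -
      have sq: "(\<Sum>i\<in>UNIV. (v x $ i)\<^sup>2) = (norm (v x))\<^sup>2"
        unfolding power2_norm_eq_inner by (simp add: inner_vec_def power2_eq_square)
      have w: "w x \<ge> 0" by (simp add: w_def)
      have B: "\<bar>B x\<bar> \<le> w x"
        unfolding B_def sq w_def using zero_le_power2[of "norm (v x)"] by arith
      have "\<bar>v x $ j\<bar> \<le> sqrt (w x)"
        using component_le_norm_cart[of "v x" j] by (intro real_le_rsqrt) (auto simp: w_def intro: order_trans[OF power_mono[of "\<bar>v x $ j\<bar>" "norm (v x)" 2, simplified]])
      also have "\<dots> = w x powr (1/2)" using w by (simp add: powr_half_sqrt)
      finally have "\<bar>v x $ j\<bar> \<le> w x powr (1/2)" .
      then have "\<bar>v x $ j\<bar> * (\<bar>B x\<bar> * \<bar>B x\<bar> powr a) \<le> w x powr (1/2) * (w x * w x powr a)"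
        using B a w by (intro mult_mono powr_mono2) auto
      also have "\<dots> = w x powr (1/2) * (w x powr 1 * w x powr a)"
        using w by simp
      also have "\<dots> = w x powr (1/2 + (1 + a))"
        by (simp only: powr_add)
      also have "1/2 + (1 + a) = q / 2" by (simp add: a_def field_simps)
      finally show ?thesis using w by (simp add: H_def F_def abs_mult)
    qed
    have m: "H j \<in> borel_measurable borel"
      using contH by (rule borel_measurable_continuous_onI)
    \<comment> \<open>The dominating function is known to be integrable for \<open>lebesgue\<close>;
      Borel measurability of \<open>H j\<close> brings the result back to
      \<open>lborel\<close>.\<close>
    have "integrable lebesgue (H j)"
    proof (rule Bochner_Integration.integrable_bound)
      show "integrable lebesgue (\<lambda>x. \<bar>w x\<bar> powr (q / 2))"
        using Lq by (simp add: in_Lp_def w_def)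
      show "H j \<in> borel_measurable lebesgue"
        using m by (intro measurable_completion) simp
    qed (use le in auto)
    then show ?thesis using m integrable_completion[of "H j" lborel] by simp
  qed
  have dF0: "dF x \<ge> 0" for x using a by (simp add: dF_def)
  have zero: "dF x * (\<Phi> x \<bullet> v x) = 0" for x
    using assms(9)
  proof
    assume "\<forall>x. \<Phi> x \<bullet> v x \<ge> 0"
    then show ?thesis
      using integrable_field_divergence_nonneg_eq_0[of UNIV H D "\<lambda>j. axis j 1" x] contH contD derH intH dF0
      by (simp add: div)
  next
    \<comment> \<open>Reversing the field reduces this sign to the previous one.\<close>
    assume neg: "\<forall>x. \<Phi> x \<bullet> v x \<le> 0"
    have "(\<Sum>j\<in>UNIV. - D j x) = 0"
    proof (rule integrable_field_divergence_nonneg_eq_0[where H="\<lambda>j x. - H j x" and u="\<lambda>j. axis j 1"])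
      show "(\<Sum>j\<in>UNIV. - D j x) \<ge> 0" for x
        using neg dF0[of x] by (simp add: sum_negf div mult_nonneg_nonpos)
    qed (auto intro!: continuous_intros contH contD derH intH DERIV_minus)
    then show ?thesis by (simp add: sum_negf div)
  qed
  show ?thesis
  proof (rule allI, rule ccontr)
    fix x assume x: "v x \<noteq> 0"
    have contv: "continuous_on UNIV v"
      using v1(1) by (intro continuous_on_vec_lambda[of UNIV "\<lambda>i y. v y $ i", simplified])
    have op: "open {y. v y \<noteq> 0}"
      by (intro open_Collect_neq contv continuous_intros)
    \<comment> \<open>By (iii) the factor \<open>\<Phi> y \<bullet> v y\<close> is nonzero here, so
      \<open>dF y = 0\<close>, and thus \<open>B y = 0\<close>.\<close>
    have B0: "B y = 0" if "v y \<noteq> 0" for y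
      using zero[of y] assms(10)[of y] that a by (simp add: dF_def)
    have "dB j x = 0" for j
    proof -
      \<comment> \<open>\<open>B\<close> vanishes on a short segment through \<open>x\<close> in
        each axis direction, so its partial derivatives at \<open>x\<close> are 0.\<close>
      have "open ((\<lambda>t. x + t *\<^sub>R axis j 1) -` {y. v y \<noteq> 0})"
        by (intro open_vimage op continuous_intros)
      then have "((\<lambda>t::real. 0) has_real_derivative dB j x) (at 0)"
        using x by (intro has_field_derivative_transform_within_open[OF derB]) (auto simp: B0)
      then show ?thesis
        using DERIV_unique DERIV_const by blast
    qed
    then have "\<Phi> x \<bullet> v x = 0" using energy[of x] by simp
    then show False using assms(10) x by simp
  qed
qed

end
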